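(* Let $\mathcal R$ be a commutative ELT ring and let $A,B\in(\overline{\mathcal R})^{n\times n}$ be such that $A$ or $B$ is invertible. Then $$\det(AB)=\det(A)\cdot\det(B).$$
   Context: Let $F$ be a totally ordered abelian group (written additively) and $L$ a commutative ring with unit. The commutative ELT ring $\mathcal R=\mathscr R(L,F)$ is the set of symbols ${}^{[\ell]}a$ ($a\in F$, $\ell\in L$) with multiplication ${}^{[\ell_1]}a_1\cdot{}^{[\ell_2]}a_2={}^{[\ell_1\ell_2]}(a_1+a_2)$ and addition ${}^{[\ell_1]}a_1+{}^{[\ell_2]}a_2$ equal to ${}^{[\ell_1]}a_1$ if $a_1>a_2$, to ${}^{[\ell_2]}a_2$ if $a_1<a_2$, and to ${}^{[\ell_1+\ell_2]}a_1$ if $a_1=a_2$. Set $\overline{\mathcal R}=\mathcal R\cup\{-\infty\}$, where $-\infty+\alpha=\alpha+(-\infty)=\alpha$ and $-\infty\cdot\alpha=\alpha\cdot(-\infty)=-\infty$; this is a commutative semiring with zero $-\infty$ and unit ${}^{[1]}0$. Matrices over $\overline{\mathcal R}$ are multiplied as usual; the identity matrix has diagonal entries ${}^{[1]}0$ and off-diagonal entries $-\infty$; a matrix is invertible if it has a two-sided inverse in $(\overline{\mathcal R})^{n\times n}$. The determinant is $\det(A)=\sum_{\sigma\in S_n}{}^{[\operatorname{sgn}\sigma]}0\cdot a_{1,\sigma(1)}\cdots a_{n,\sigma(n)}$. *)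

theory Defs
  imports "HOL-Analysis.Determinants"
begin

text \<open>
  The ELT semiring with the zero element adjoined. \<open>Elt l a\<close> is the symbol with layer \<open>l\<close> (in the
  ring \<open>L\<close>) and value \<open>a\<close> (in the ordered group \<open>F\<close>). Note that \<open>Elt 0 a\<close> is different from \<open>MInf\<close>.
\<close>

datatype ('l, 'f) elt = MInf (\<open>-\<infinity>\<^sub>E\<close>) | Elt (layer: 'l) (tval: 'f)

text \<open>
  The sort \<open>{comm_ring, comm_monoid_mult}\<close> of \<open>L\<close> is that of commutative rings with unit, the zero ring
  included; \<open>comm_ring_1\<close> would in addition demand \<open>0 \<noteq> 1\<close> in \<open>L\<close>.
\<close>

instantiation elt :: ("{comm_ring, comm_monoid_mult}", linordered_ab_group_add) comm_semiring_1
begin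

definition zero_elt :: "('a, 'b) elt" where
  "0 = -\<infinity>\<^sub>E"

definition one_elt :: "('a, 'b) elt" where
  "1 = Elt 1 0"

fun plus_elt :: "('a, 'b) elt \<Rightarrow> ('a, 'b) elt \<Rightarrow> ('a, 'b) elt" where
  "-\<infinity>\<^sub>E + y = y"
| "Elt l a + -\<infinity>\<^sub>E = Elt l a"
| "Elt l1 a1 + Elt l2 a2 =
     (if a1 > a2 then Elt l1 a1 else if a1 < a2 then Elt l2 a2 else Elt (l1 + l2) a1)"

fun times_elt :: "('a, 'b) elt \<Rightarrow> ('a, 'b) elt \<Rightarrow> ('a, 'b) elt" where
  "-\<infinity>\<^sub>E * y = -\<infinity>\<^sub>E"
| "Elt l a * -\<infinity>\<^sub>E = -\<infinity>\<^sub>E"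
| "Elt l1 a1 * Elt l2 a2 = Elt (l1 * l2) (a1 + a2)"

instance
proof
  fix a b c :: "('a, 'b) elt"
  show "a + b + c = a + (b + c)"
    by (cases a; cases b; cases c) (auto simp: add.assoc)
  show "a + b = b + a"
    by (cases a; cases b) (auto simp: add.commute)
  show "0 + a = a"
    by (simp add: zero_elt_def)
  show "a * b * c = a * (b * c)"
    by (cases a; cases b; cases c) (auto simp: mult.assoc add.assoc)
  show "a * b = b * a"
    by (cases a; cases b) (auto simp: mult.commute add.commute)
  show "1 * a = a"
    by (cases a) (auto simp: one_elt_def)
  show "(a + b) * c = a * c + b * c"
    by (cases a; cases b; cases c) (auto simp: distrib_right)
  show "0 * a = 0"
    by (simp add: zero_elt_def)
  show "a * 0 = 0"
    by (cases a) (auto simp: zero_elt_def)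
  show "(0 :: ('a, 'b) elt) \<noteq> 1"
    by (simp add: zero_elt_def one_elt_def)
qed

end

text \<open>
  The library's \<open>det\<close> needs subtraction, which this semiring lacks; here the sign of a permutation
  enters through the layer of the first factor.
\<close>

definition elt_sign :: "('n \<Rightarrow> 'n) \<Rightarrow> ('l::{comm_ring, comm_monoid_mult}, 'f::linordered_ab_group_add) elt"
  where "elt_sign \<sigma> = Elt (if evenperm \<sigma> then 1 else - 1) 0"

definition elt_det ::
    "('l::{comm_ring, comm_monoid_mult}, 'f::linordered_ab_group_add) elt ^ 'n ^ 'n \<Rightarrow> ('l, 'f) elt"
  where "elt_det A = (\<Sum>\<sigma> | \<sigma> permutes UNIV. elt_sign \<sigma> * (\<Prod>i\<in>UNIV. A $ i $ \<sigma> i))"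

end

theory Submission imports Defs begin

text \<open>
  A ghost \<open>Elt 0 a\<close> is not \<open>-\<infinity>\<^sub>E\<close>, and neither addition nor multiplication can turn nonzero
  elements into \<open>-\<infinity>\<^sub>E\<close>. So a sum vanishes only if each summand does, and there are no zero
  divisors, whatever the ring of layers is. Over such a semiring an invertible matrix is
  monomial, that is, it has exactly one nonzero entry in each row and each column: if
  \<open>A ** C = mat 1\<close>, every off-diagonal entry of the product vanishes term by term
  (\<open>right_invertible_imp_monomial\<close>).

  For a monomial factor the determinant is multiplicative without any cancellation. Multiplying
  by \<open>A\<close> from the left scales the rows of \<open>B\<close> and permutes them by some \<open>p\<close>, and the sum over all
  permutations is then reindexed by composition with \<open>p\<close>, which produces the sign of \<open>p\<close>
  (\<open>elt_det_monomial_mult\<close>). Transposition exchanges the two factors and so covers the case in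
  which \<open>B\<close> is invertible.
\<close>

lemma elt_plus_eq_0_iff:
  fixes x y :: "('l::{comm_ring, comm_monoid_mult}, 'f::linordered_ab_group_add) elt"
  shows "x + y = 0 \<longleftrightarrow> x = 0 \<and> y = 0"
  by (cases x; cases y) (auto simp: zero_elt_def)

lemma elt_times_eq_0_iff:
  fixes x y :: "('l::{comm_ring, comm_monoid_mult}, 'f::linordered_ab_group_add) elt"
  shows "x * y = 0 \<longleftrightarrow> x = 0 \<or> y = 0"
  by (cases x; cases y) (auto simp: zero_elt_def)

lemma elt_sum_eq_0_iff:
  fixes f :: "'i \<Rightarrow> ('l::{comm_ring, comm_monoid_mult}, 'f::linordered_ab_group_add) elt"
  assumes "finite I"
  shows "sum f I = 0 \<longleftrightarrow> (\<forall>i\<in>I. f i = 0)"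
  using assms by induction (auto simp: elt_plus_eq_0_iff)

lemma elt_sign_comp:
  assumes "permutation \<sigma>" "permutation \<tau>"
  shows "elt_sign (\<sigma> \<circ> \<tau>) =
    (elt_sign \<sigma> * elt_sign \<tau> :: ('l::{comm_ring, comm_monoid_mult}, 'f::linordered_ab_group_add) elt)"
proof -
  \<comment> \<open>The layers form a ring with unit but not of class \<open>comm_ring_1\<close>, since \<open>0 = 1\<close> is possible,
    so the sign rule is derived from the ring and monoid laws.\<close>
  have "(- 1) * (- 1 :: 'l) = 1"
    by (simp only: minus_mult_minus mult_1)
  moreover have "1 * x = x" "x * 1 = x" for x :: 'l
    by simp_all
  ultimately show ?thesis
    unfolding elt_sign_def by (simp add: evenperm_comp assms)
qed

lemma elt_sign_inv:
  assumes "permutation \<sigma>"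
  shows "elt_sign (inv \<sigma>) = elt_sign \<sigma>"
  unfolding elt_sign_def by (simp add: evenperm_inv assms)

text \<open>
  Reindexing the products by \<open>\<sigma>\<close> turns the term of \<open>\<sigma>\<close> for the transpose into the term of
  \<open>inv \<sigma>\<close> for \<open>A\<close>, and the two permutations have the same sign.
\<close>

lemma elt_det_transpose:
  fixes A :: "('l::{comm_ring, comm_monoid_mult}, 'f::linordered_ab_group_add) elt ^ 'n ^ 'n"
  shows "elt_det (transpose A) = elt_det A"
proof -
  have "elt_det A = (\<Sum>\<sigma> | \<sigma> permutes UNIV. elt_sign (inv \<sigma>) * (\<Prod>i\<in>UNIV. A $ i $ inv \<sigma> i))"
    unfolding elt_det_def by (rule sum_permutations_inverse)
  also have "\<dots> = (\<Sum>\<sigma> | \<sigma> permutes UNIV. elt_sign \<sigma> * (\<Prod>i\<in>UNIV. transpose A $ i $ \<sigma> i))"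
  proof (rule sum.cong[OF refl])
    fix \<sigma> :: "'n \<Rightarrow> 'n"
    assume "\<sigma> \<in> {\<sigma>. \<sigma> permutes UNIV}"
    then have \<sigma>: "\<sigma> permutes UNIV" by simp
    have "(\<Prod>i\<in>UNIV. A $ i $ inv \<sigma> i) = (\<Prod>i\<in>UNIV. A $ \<sigma> i $ inv \<sigma> (\<sigma> i))"
      by (rule prod.permute[OF \<sigma>, unfolded o_def])
    also have "\<dots> = (\<Prod>i\<in>UNIV. transpose A $ i $ \<sigma> i)"
      by (simp add: transpose_def permutes_inverses(2)[OF \<sigma>])
    finally show "elt_sign (inv \<sigma>) * (\<Prod>i\<in>UNIV. A $ i $ inv \<sigma> i) =
        elt_sign \<sigma> * (\<Prod>i\<in>UNIV. transpose A $ i $ \<sigma> i)"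
      using \<sigma> by (simp add: elt_sign_inv permutation_permutes exI[of _ UNIV])
  qed
  finally show ?thesis
    unfolding elt_det_def by simp
qed

text \<open>
  The diagonal entries of \<open>A ** C = mat 1\<close> are nonzero, which provides for each row \<open>i\<close> a column
  \<open>p i\<close> with \<open>A $ i $ p i\<close> and \<open>C $ p i $ i\<close> both nonzero. The off-diagonal entries are zero, so
  \<open>A $ j $ p i * C $ p i $ i = 0\<close> for \<open>j \<noteq> i\<close>, and the column \<open>p i\<close> of \<open>A\<close> has no other nonzero
  entry. This makes \<open>p\<close> injective, hence a permutation of the finite index type.
\<close>

lemma right_invertible_imp_monomial:
  fixes A C :: "('l::{comm_ring, comm_monoid_mult}, 'f::linordered_ab_group_add) elt ^ 'n ^ 'n"
  assumes AC: "A ** C = mat 1"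
  obtains p where "p permutes UNIV" "\<And>i k. k \<noteq> p i \<Longrightarrow> A $ i $ k = 0"
proof -
  have entry: "(\<Sum>k\<in>UNIV. A $ i $ k * C $ k $ j) = (if i = j then 1 else 0)" for i j
  proof -
    have "(A ** C) $ i $ j = mat 1 $ i $ j" by (simp add: AC)
    then show ?thesis by (simp add: matrix_matrix_mult_def mat_def)
  qed
  have "\<exists>k. A $ i $ k \<noteq> 0 \<and> C $ k $ i \<noteq> 0" for i
  proof -
    have "(\<Sum>k\<in>UNIV. A $ i $ k * C $ k $ i) \<noteq> 0"
      using entry[of i i] by simp
    then show ?thesis
      by (auto simp: elt_sum_eq_0_iff elt_times_eq_0_iff)
  qed
  then obtain p where p: "\<And>i. A $ i $ p i \<noteq> 0" "\<And>i. C $ p i $ i \<noteq> 0"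
    by metis
  have column: "A $ i $ p j = 0" if "i \<noteq> j" for i j
  proof -
    have "(\<Sum>k\<in>UNIV. A $ i $ k * C $ k $ j) = 0"
      using entry[of i j] that by simp
    then have "A $ i $ p j * C $ p j $ j = 0"
      by (simp add: elt_sum_eq_0_iff)
    then show ?thesis
      using p(2) by (simp add: elt_times_eq_0_iff)
  qed
  have "inj p"
    using column p(1) by (metis injI)
  then have "bij p"
    by (simp add: bij_def finite_UNIV_inj_surj)
  then have perm: "p permutes UNIV"
    by (intro bij_imp_permutes) auto
  have "A $ i $ k = 0" if "k \<noteq> p i" for i k
    using column that \<open>bij p\<close> by (metis bij_pointE)
  with perm show ?thesis
    by (rule that)
qed

lemma elt_det_monomial_mult:
  fixes A B :: "('l::{comm_ring, comm_monoid_mult}, 'f::linordered_ab_group_add) elt ^ 'n ^ 'n"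
  assumes p: "p permutes UNIV" and A: "\<And>i k. k \<noteq> p i \<Longrightarrow> A $ i $ k = 0"
  shows "elt_det (A ** B) = elt_det A * elt_det B"
proof -
  define d where "d = (\<Prod>i\<in>UNIV. A $ i $ p i)"
  have perm: "permutation \<sigma>" if "\<sigma> permutes UNIV" for \<sigma> :: "'n \<Rightarrow> 'n"
    using that by (auto simp: permutation_permutes)
  have detA: "elt_det A = elt_sign p * d"
  proof -
    have "(\<Prod>i\<in>UNIV. A $ i $ \<sigma> i) = 0" if neq: "\<sigma> \<noteq> p" for \<sigma>
    proof -
      obtain i where "\<sigma> i \<noteq> p i" using neq by (auto simp: fun_eq_iff)
      then show ?thesis using A by (intro prod_zero) auto
    qed
    then have "elt_det A =
        (\<Sum>\<sigma>\<in>{p}. elt_sign \<sigma> * (\<Prod>i\<in>UNIV. A $ i $ \<sigma> i))"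
      unfolding elt_det_def using p
      by (intro sum.mono_neutral_right) (auto simp: finite_permutations)
    then show ?thesis by (simp add: d_def)
  qed
  have AB: "(A ** B) $ i $ j = A $ i $ p i * B $ p i $ j" for i j
  proof -
    have "(\<Sum>k\<in>UNIV. A $ i $ k * B $ k $ j) = (\<Sum>k\<in>{p i}. A $ i $ k * B $ k $ j)"
      by (rule sum.mono_neutral_right) (auto simp: A)
    then show ?thesis by (simp add: matrix_matrix_mult_def)
  qed
  have "elt_det (A ** B) =
      (\<Sum>\<sigma> | \<sigma> permutes UNIV. elt_sign \<sigma> * (d * (\<Prod>i\<in>UNIV. B $ p i $ \<sigma> i)))"
    unfolding elt_det_def d_def by (simp add: AB prod.distrib)
  also have "\<dots> = (\<Sum>\<tau> | \<tau> permutes UNIV.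
      elt_sign (\<tau> \<circ> p) * (d * (\<Prod>i\<in>UNIV. B $ p i $ (\<tau> \<circ> p) i)))"
    by (rule sum_permutations_compose_right[OF p])
  also have "\<dots> = (\<Sum>\<tau> | \<tau> permutes UNIV.
      (elt_sign p * d) * (elt_sign \<tau> * (\<Prod>i\<in>UNIV. B $ i $ \<tau> i)))"
  proof (rule sum.cong[OF refl])
    fix \<tau> :: "'n \<Rightarrow> 'n"
    assume "\<tau> \<in> {\<tau>. \<tau> permutes UNIV}"
    then have "permutation \<tau>" using perm by simp
    moreover have "(\<Prod>i\<in>UNIV. B $ i $ \<tau> i) = (\<Prod>i\<in>UNIV. B $ p i $ (\<tau> \<circ> p) i)"
      using prod.permute[OF p, of "\<lambda>i. B $ i $ \<tau> i"] by (simp add: o_def)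
    ultimately show "elt_sign (\<tau> \<circ> p) * (d * (\<Prod>i\<in>UNIV. B $ p i $ (\<tau> \<circ> p) i)) =
        (elt_sign p * d) * (elt_sign \<tau> * (\<Prod>i\<in>UNIV. B $ i $ \<tau> i))"
      by (simp only: elt_sign_comp perm[OF p] ac_simps)
  qed
  also have "\<dots> = elt_det A * elt_det B"
    unfolding detA by (simp add: elt_det_def sum_distrib_left)
  finally show ?thesis .
qed

lemma elt_det_mult_left_invertible:
  fixes A B :: "('l::{comm_ring, comm_monoid_mult}, 'f::linordered_ab_group_add) elt ^ 'n ^ 'n"
  assumes "invertible A"
  shows "elt_det (A ** B) = elt_det A * elt_det B"
proof -
  obtain C where "A ** C = mat 1"
    using assms by (auto simp: invertible_def)
  then obtain p where "p permutes UNIV" "\<And>i k. k \<noteq> p i \<Longrightarrow> A $ i $ k = 0"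
    by (rule right_invertible_imp_monomial) blast
  then show ?thesis
    by (rule elt_det_monomial_mult)
qed

theorem theorem2p17:
  fixes A B :: "('l::{comm_ring, comm_monoid_mult}, 'f::linordered_ab_group_add) elt ^ 'n ^ 'n"
  assumes "invertible A \<or> invertible B"
  shows "elt_det (A ** B) = elt_det A * elt_det B"
  using assms
proof
  assume "invertible A"
  then show ?thesis
    by (rule elt_det_mult_left_invertible)
next
  assume "invertible B"
  then obtain C where "B ** C = mat 1" "C ** B = mat 1"
    by (auto simp: invertible_def)
  then have "transpose C ** transpose B = mat 1" "transpose B ** transpose C = mat 1"
    by (simp_all flip: matrix_transpose_mul)
  then have "invertible (transpose B)"
    by (auto simp: invertible_def)
  then have "elt_det (transpose B ** transpose A) = elt_det (transpose B) * elt_det (transpose A)"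
    by (rule elt_det_mult_left_invertible)
  then show ?thesis
    by (simp add: elt_det_transpose mult.commute flip: matrix_transpose_mul)
qed

end
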